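(* Let $L$ be a complete lattice. For a subset $\mathcal{C}\subseteq L$, the map $\mathcal{D}(\mathcal{C})\to L$ given by $S\mapsto\bigvee S$ (join in $L$) has a right Galois adjoint if and only if $\mathcal{C}$ equipped with the induced partial order is a subchainmail of $L$.
   Context: Mail: in a poset $P$, a mail is a non-empty subset of $P$ having a common lower bound in $P$. A subset $M$ of $P$ is mail-connected if $M\neq\varnothing$ and for any $x,y\in M$ there is a sequence $s_1,\dots,s_n\in M$ with $s_1=x$, $s_n=y$ and each $\{s_i,s_{i+1}\}$ ($1\le i\le n-1$) a mail in $P$. A subset $\mathcal{C}$ of a complete lattice $L$ (with the induced order) is a subchainmail of $L$ if for every subset $M\subseteq\mathcal{C}$ that is mail-connected in the poset $\mathcal{C}$ (so common lower bounds are taken in $\mathcal{C}$), the join of $M$ in $L$ belongs to $\mathcal{C}$. A subset $S$ of a poset $P$ (possibly empty) is totally mail-disconnected in $P$ if no two distinct elements of $S$ have a common lower bound in $P$. $\mathcal{D}(P)$ denotes the poset of totally mail-disconnected subsets of $P$, ordered by: $D_1\leqslant D_2$ iff each element of $D_1$ is below some element of $D_2$. Here $\mathcal{D}(\mathcal{C})$ is formed for $\mathcal{C}$ with the order induced from $L$ (common lower bounds are taken in $\mathcal{C}$). *)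

theory Defs
  imports "HOL-Algebra.Galois_Connection"
begin

text \<open>
  Posets are order records satisfying the locale \<open>partial_order\<close>. A subset \<open>C\<close> of
  \<open>L\<close> with the induced order is the record \<open>L\<lparr>carrier := C\<rparr>\<close>. Since \<open>Lower P A\<close>
  collects lower bounds from \<open>carrier P\<close> only, common lower bounds in
  \<open>L\<lparr>carrier := C\<rparr>\<close> are elements of \<open>C\<close>.
\<close>

definition mail :: "('a, 'm) gorder_scheme \<Rightarrow> 'a set \<Rightarrow> bool" where
  "mail P A \<longleftrightarrow> A \<subseteq> carrier P \<and> A \<noteq> {} \<and> Lower P A \<noteq> {}"

definition mail_connected :: "('a, 'm) gorder_scheme \<Rightarrow> 'a set \<Rightarrow> bool" where
  "mail_connected P M \<longleftrightarrow> M \<subseteq> carrier P \<and> M \<noteq> {} \<and>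
     (\<forall>x\<in>M. \<forall>y\<in>M. \<exists>s. s \<noteq> [] \<and> set s \<subseteq> M \<and> hd s = x \<and> last s = y \<and>
        successively (\<lambda>a b. mail P {a, b}) s)"

definition subchainmail :: "('a, 'm) gorder_scheme \<Rightarrow> 'a set \<Rightarrow> bool" where
  "subchainmail L C \<longleftrightarrow> C \<subseteq> carrier L \<and>
     (\<forall>M. M \<subseteq> C \<longrightarrow> mail_connected (L\<lparr>carrier := C\<rparr>) M \<longrightarrow> \<Squnion>\<^bsub>L\<^esub> M \<in> C)"

definition totally_mail_disconnected :: "('a, 'm) gorder_scheme \<Rightarrow> 'a set \<Rightarrow> bool" where
  "totally_mail_disconnected P S \<longleftrightarrow> S \<subseteq> carrier P \<and>
     (\<forall>x\<in>S. \<forall>y\<in>S. x \<noteq> y \<longrightarrow> Lower P {x, y} = {})"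

definition disconnected_poset :: "('a, 'm) gorder_scheme \<Rightarrow> 'a set gorder" where
  "disconnected_poset P =
     \<lparr>carrier = {S. totally_mail_disconnected P S}, eq = (=),
      le = (\<lambda>S T. \<forall>x\<in>S. \<exists>y\<in>T. x \<sqsubseteq>\<^bsub>P\<^esub> y)\<rparr>"

text \<open>
  The locale \<open>galois_connection\<close> includes the condition that both sides are partial
  orders. The following shows that this is automatic for \<open>disconnected_poset\<close>.
\<close>

lemma partial_order_carrier_update:
  assumes "partial_order L" and "C \<subseteq> carrier L"
  shows "partial_order (L\<lparr>carrier := C\<rparr>)"
proof -
  interpret partial_order L by fact
  have c: "x \<in> carrier L" if "x \<in> C" for x
    using assms(2) that by blast
  show ?thesis
    by unfold_locales
      (auto simp: eq_is_equal dest!: c intro: le_antisym le_trans)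
qed

lemma totally_mail_disconnected_dominated:
  assumes P: "partial_order P"
    and S: "totally_mail_disconnected P S" and T: "totally_mail_disconnected P T"
    and ST: "\<forall>x\<in>S. \<exists>y\<in>T. x \<sqsubseteq>\<^bsub>P\<^esub> y" and TS: "\<forall>x\<in>T. \<exists>y\<in>S. x \<sqsubseteq>\<^bsub>P\<^esub> y"
  shows "S \<subseteq> T"
proof
  interpret partial_order P by fact
  fix x assume x: "x \<in> S"
  then obtain y where y: "y \<in> T" "x \<sqsubseteq>\<^bsub>P\<^esub> y" using ST by blast
  then obtain z where z: "z \<in> S" "y \<sqsubseteq>\<^bsub>P\<^esub> z" using TS by blast
  have c: "x \<in> carrier P" "y \<in> carrier P" "z \<in> carrier P"
    using x y z S T unfolding totally_mail_disconnected_def by blast+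
  have "x \<sqsubseteq>\<^bsub>P\<^esub> z" using y(2) z(2) c by (rule le_trans)
  then have "x \<in> Lower P {x, z}" using c by (auto simp: Lower_def)
  then have "x = z" using x z(1) S unfolding totally_mail_disconnected_def by blast
  then have "x = y" using y(2) z(2) c by (auto intro: le_antisym)
  then show "x \<in> T" using y(1) by simp
qed

lemma partial_order_disconnected_poset:
  assumes "partial_order P"
  shows "partial_order (disconnected_poset P)"
proof -
  interpret partial_order P by fact
  have c: "x \<in> carrier P" if "totally_mail_disconnected P S" "x \<in> S" for x S
    using that unfolding totally_mail_disconnected_def by blast
  show ?thesis
  proof (unfold_locales, goal_cases)
    case (4 S)
    then show ?case by (auto simp: disconnected_poset_def) (meson c le_refl)
  next
    case (5 S T)
    then show ?case
      using totally_mail_disconnected_dominated[OF assms, of S T]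
        totally_mail_disconnected_dominated[OF assms, of T S]
      by (auto simp: disconnected_poset_def)
  next
    case (6 S T U)
    then show ?case
      by (auto simp: disconnected_poset_def) (meson c le_trans)
  qed (auto simp: disconnected_poset_def)
qed

end

theory Submission
  imports Defs
begin

text \<open>
  Let \<open>g\<close> be a right adjoint and let \<open>M\<close> be mail-connected with join \<open>y\<close>. Every \<open>{x}\<close> with
  \<open>x \<in> M\<close> lies below \<open>g y\<close>, and elements of \<open>M\<close> joined by a mail lie below the same element of
  the totally mail-disconnected set \<open>g y\<close>. So all of \<open>M\<close> lies below one \<open>t \<in> g y\<close>, whence
  \<open>y = t \<in> C\<close>. Conversely, the adjoint sends \<open>y\<close> to the set of joins of the mail-connected
  components of \<open>{c \<in> C. c \<sqsubseteq> y}\<close>: the join of a component belongs to that same component, so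
  distinct joins have no common lower bound.
\<close>

section \<open>Mail-connectedness as reachability, and components\<close>

definition mail_links :: "('a, 'm) gorder_scheme \<Rightarrow> 'a set \<Rightarrow> ('a \<times> 'a) set" where
  "mail_links P A = {(a, b). a \<in> A \<and> b \<in> A \<and> mail P {a, b}}"

text \<open>The closure is reflexive on the whole type, so the component contains \<open>x\<close>
  even when \<open>x\<close> lies outside \<open>A\<close>; hence the assumption in
  \<open>mail_component_subset\<close>.\<close>

definition mail_component :: "('a, 'm) gorder_scheme \<Rightarrow> 'a set \<Rightarrow> 'a \<Rightarrow> 'a set" where
  "mail_component P A x = (mail_links P A)\<^sup>* `` {x}"

lemma mail_links_rtrancl_sym:
  assumes "(x, y) \<in> (mail_links P A)\<^sup>*"
  shows "(y, x) \<in> (mail_links P A)\<^sup>*"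
proof -
  have "sym (mail_links P A)"
    by (auto simp: sym_def mail_links_def insert_commute)
  then show ?thesis
    using assms by (rule symD[OF sym_rtrancl])
qed

lemma successively_imp_mail_links_rtrancl:
  assumes "successively (\<lambda>a b. mail P {a, b}) s" and "s \<noteq> []" and "set s \<subseteq> A"
  shows "(hd s, last s) \<in> (mail_links P A)\<^sup>*"
  using assms
proof (induction s)
  case (Cons a s)
  show ?case
  proof (cases "s = []")
    case False
    then have "(a, hd s) \<in> mail_links P A"
      using Cons.prems by (auto simp: successively_Cons mail_links_def)
    then show ?thesis
      using Cons False by (auto simp: successively_Cons intro: converse_rtrancl_into_rtrancl)
  qed simp
qed simp

text \<open>The empty path exists at every element of the type; \<open>y \<in> A\<close> keeps its
  list \<open>[y]\<close> inside \<open>A\<close>.\<close>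

lemma mail_links_rtrancl_imp_successively:
  assumes "(x, y) \<in> (mail_links P A)\<^sup>*" and "y \<in> A"
  shows "\<exists>s. s \<noteq> [] \<and> set s \<subseteq> A \<and> hd s = x \<and> last s = y \<and>
    successively (\<lambda>a b. mail P {a, b}) s"
  using assms
proof (induction rule: converse_rtrancl_induct)
  case base
  then show ?case by (intro exI[of _ "[y]"]) simp
next
  case (step x z)
  then obtain s where "s \<noteq> []" "set s \<subseteq> A" "hd s = z" "last s = y"
    "successively (\<lambda>a b. mail P {a, b}) s"
    by blast
  then show ?case
    using step.hyps(1)
    by (intro exI[of _ "x # s"]) (auto simp: successively_Cons mail_links_def)
qed

text \<open>Trades lists for a closure, which offers induction, symmetry and transitivity.\<close>

lemma mail_connected_iff_mail_links:
  "mail_connected P M \<longleftrightarrow>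
     M \<subseteq> carrier P \<and> M \<noteq> {} \<and> (\<forall>x\<in>M. \<forall>y\<in>M. (x, y) \<in> (mail_links P M)\<^sup>*)"
proof -
  have "(\<exists>s. s \<noteq> [] \<and> set s \<subseteq> M \<and> hd s = x \<and> last s = y \<and>
      successively (\<lambda>a b. mail P {a, b}) s) \<longleftrightarrow> (x, y) \<in> (mail_links P M)\<^sup>*" if "y \<in> M" for x y
    by (rule iffI) (auto dest: successively_imp_mail_links_rtrancl
        mail_links_rtrancl_imp_successively[OF _ that])
  then show ?thesis
    by (simp add: mail_connected_def)
qed

lemma mail_component_subset:
  assumes "x \<in> A"
  shows "mail_component P A x \<subseteq> A"
proof
  fix y assume "y \<in> mail_component P A x"
  then have "(x, y) \<in> (mail_links P A)\<^sup>*"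
    by (simp add: mail_component_def)
  then show "y \<in> A"
    using assms by (induction rule: rtrancl_induct) (auto simp: mail_links_def)
qed

lemma mail_component_self: "x \<in> mail_component P A x"
  by (simp add: mail_component_def)

lemma mail_component_eq:
  assumes "(x, y) \<in> (mail_links P A)\<^sup>*"
  shows "mail_component P A x = mail_component P A y"
  using assms mail_links_rtrancl_sym[OF assms]
  by (auto simp: mail_component_def intro: rtrancl_trans)

text \<open>A path starting at \<open>x\<close> never leaves the component, so its links are links
  of the component itself. Any two points are then joined through \<open>x\<close> by
  symmetry.\<close>

lemma mail_connected_mail_component:
  assumes "A \<subseteq> carrier P" and "x \<in> A"
  shows "mail_connected P (mail_component P A x)"
proof -
  let ?K = "mail_component P A x"
  have path: "(x, y) \<in> (mail_links P ?K)\<^sup>*" if "(x, y) \<in> (mail_links P A)\<^sup>*" for y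
    using that
  proof (induction rule: rtrancl_induct)
    case (step y z)
    then have "(y, z) \<in> mail_links P ?K"
      by (auto simp: mail_component_def mail_links_def intro: rtrancl_into_rtrancl)
    with step.IH show ?case by (rule rtrancl_into_rtrancl)
  qed simp
  have "(y, z) \<in> (mail_links P ?K)\<^sup>*" if "y \<in> ?K" "z \<in> ?K" for y z
    using that path[of y] path[of z] mail_links_rtrancl_sym[of x y P ?K]
    by (auto simp: mail_component_def intro: rtrancl_trans)
  moreover have "?K \<subseteq> carrier P"
    using mail_component_subset[OF assms(2)] assms(1) by (rule subset_trans)
  ultimately show ?thesis
    using mail_component_self[of x P A] by (auto simp: mail_connected_iff_mail_links)
qed

section \<open>Mail-connected sets below totally mail-disconnected ones\<close>

lemma (in partial_order) mail_insert_iff: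
  assumes "x \<in> carrier L" and "y \<in> carrier L"
  shows "mail L {x, y} \<longleftrightarrow> (\<exists>c\<in>carrier L. c \<sqsubseteq> x \<and> c \<sqsubseteq> y)"
  using assms by (auto simp: mail_def Lower_def)

lemma (in partial_order) mail_if_le:
  assumes "x \<in> carrier L" and "y \<in> carrier L" and "x \<sqsubseteq> y"
  shows "mail L {x, y}"
  using assms mail_insert_iff by blast

lemma (in partial_order) totally_mail_disconnected_unique:
  assumes "totally_mail_disconnected L S" and "s \<in> S" and "t \<in> S"
    and "c \<in> carrier L" and "c \<sqsubseteq> s" and "c \<sqsubseteq> t"
  shows "s = t"
  using assms by (auto simp: totally_mail_disconnected_def Lower_def)

text \<open>The bound \<open>t\<close> of one point propagates along links: a common lower bound of
  neighbours \<open>y\<close> and \<open>z\<close> lies below \<open>t\<close> and below any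
  \<open>u \<in> T\<close> above \<open>z\<close>, which forces \<open>t = u\<close>.\<close>

lemma (in partial_order) mail_connected_below_common:
  assumes M: "mail_connected L M" and T: "totally_mail_disconnected L T"
    and below: "\<And>x. x \<in> M \<Longrightarrow> \<exists>t\<in>T. x \<sqsubseteq> t"
  shows "\<exists>t\<in>T. \<forall>x\<in>M. x \<sqsubseteq> t"
proof -
  have Mc: "M \<subseteq> carrier L" and Tc: "T \<subseteq> carrier L"
    using M T by (auto simp: mail_connected_def totally_mail_disconnected_def)
  obtain x where x: "x \<in> M"
    using M by (auto simp: mail_connected_def)
  then obtain t where t: "t \<in> T" "x \<sqsubseteq> t"
    using below by blast
  have "y \<sqsubseteq> t" if "(x, y) \<in> (mail_links L M)\<^sup>*" for y
    using that
  proof (induction rule: rtrancl_induct)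
    case (step y z)
    then have yz: "y \<in> M" "z \<in> M" "mail L {y, z}"
      by (auto simp: mail_links_def)
    moreover have yz': "y \<in> carrier L" "z \<in> carrier L"
      using yz Mc by auto
    ultimately obtain c where c: "c \<in> carrier L" "c \<sqsubseteq> y" "c \<sqsubseteq> z"
      using mail_insert_iff by auto
    obtain u where u: "u \<in> T" "z \<sqsubseteq> u"
      using below yz by blast
    have "c \<sqsubseteq> t" "c \<sqsubseteq> u"
      using le_trans[of c y t] le_trans[of c z u] c yz' u t step.IH Tc by auto
    then have "t = u"
      using totally_mail_disconnected_unique[OF T] t u c by simp
    with u show ?case by simp
  qed (rule t)
  moreover have "(x, y) \<in> (mail_links L M)\<^sup>*" if "y \<in> M" for y
    using M x that by (simp add: mail_connected_iff_mail_links)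
  ultimately show ?thesis
    using t(1) by blast
qed

section \<open>From a right adjoint to a subchainmail\<close>

lemma (in complete_lattice) subchainmail_if_adjoint:
  assumes C: "C \<subseteq> carrier L"
    and G: "galois_connection
      \<lparr>orderA = disconnected_poset (L\<lparr>carrier := C\<rparr>), orderB = L,
       lower = (\<lambda>S. \<Squnion>S), upper = g\<rparr>"
  shows "subchainmail L C"
  unfolding subchainmail_def
proof (intro conjI allI impI)
  let ?P = "L\<lparr>carrier := C\<rparr>"
  interpret P: partial_order ?P
    using partial_order_axioms C by (rule partial_order_carrier_update)
  fix M assume MC: "M \<subseteq> C" and M: "mail_connected ?P M"
  let ?y = "\<Squnion>M"
  have Mc: "M \<subseteq> carrier L"
    using MC C by blast
  then have y: "?y \<in> carrier L" by simp
  have g: "totally_mail_disconnected ?P (g ?y)"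
    using connection.upper_closed[OF galois_connection.axioms(1)[OF G], of ?y] y
    by (simp add: disconnected_poset_def)
  then have gC: "g ?y \<subseteq> C"
    by (simp add: totally_mail_disconnected_def)
  \<comment> \<open>Singletons are totally mail-disconnected, so the adjunction at
    \<open>{x}\<close> turns \<open>x \<sqsubseteq> ?y\<close> into the claim.\<close>
  have "\<exists>t\<in>g ?y. x \<sqsubseteq> t" if x: "x \<in> M" for x
  proof -
    have "\<Squnion>{x} = x"
      using x Mc by (intro sup_of_singleton) blast
    then have "\<Squnion>{x} \<sqsubseteq> ?y"
      using sup_upper[OF Mc x] by simp
    moreover have "totally_mail_disconnected ?P {x}"
      using x MC by (auto simp: totally_mail_disconnected_def)
    ultimately show ?thesis
      using galois_connection.right[OF G, of "{x}" ?y] y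
      by (simp add: disconnected_poset_def)
  qed
  then obtain t where t: "t \<in> g ?y" "\<forall>x\<in>M. x \<sqsubseteq> t"
    using P.mail_connected_below_common[OF M g] by auto
  have gc: "g ?y \<subseteq> carrier L" and tc: "t \<in> carrier L"
    using gC C t by blast+
  \<comment> \<open>The cycle \<open>?y \<sqsubseteq> t \<sqsubseteq> \<Squnion>(g ?y) \<sqsubseteq>
    ?y\<close> collapses; its last inequality is the counit of the adjunction.\<close>
  have "?y \<sqsubseteq> t"
    using t Mc tc by (intro sup_least) auto
  moreover have "t \<sqsubseteq> \<Squnion>(g ?y)"
    using gc t by (intro sup_upper) auto
  moreover have "\<Squnion>(g ?y) \<sqsubseteq> ?y"
    using galois_connection.deflation[OF G, of ?y] y by simp
  ultimately have "?y = t"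
    using y tc gc by (meson le_antisym le_trans sup_closed)
  then show "?y \<in> C"
    using t gC by blast
qed (rule C)

section \<open>From a subchainmail to a right adjoint\<close>

lemma (in complete_lattice) adjoint_if_subchainmail:
  assumes sub: "subchainmail L C"
  defines "P \<equiv> L\<lparr>carrier := C\<rparr>"
  defines "g \<equiv> (\<lambda>y. (\<lambda>x. \<Squnion>(mail_component P {c \<in> C. c \<sqsubseteq> y} x)) ` {c \<in> C. c \<sqsubseteq> y})"
  shows "galois_connection
    \<lparr>orderA = disconnected_poset P, orderB = L, lower = (\<lambda>S. \<Squnion>S), upper = g\<rparr>"
proof -
  have C: "C \<subseteq> carrier L"
    using sub by (simp add: subchainmail_def)
  interpret P: partial_order P
    unfolding P_def using partial_order_axioms C by (rule partial_order_carrier_update)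
  have [simp]: "carrier P = C" "le P = le L"
    by (simp_all add: P_def)
  define A where "A y = {c \<in> C. c \<sqsubseteq> y}" for y
  define j where "j y x = \<Squnion>(mail_component P (A y) x)" for x y
  have g_eq: "g y = j y ` A y" for y
    by (simp add: g_def A_def j_def)
  have A_sub: "A y \<subseteq> C" "A y \<subseteq> carrier L" for y
    using C by (auto simp: A_def)
  have j_upper: "x \<sqsubseteq> j y x" if "x \<in> A y" for x y
    unfolding j_def using mail_component_subset[OF that, of P] A_sub(2)[of y]
    by (intro sup_upper mail_component_self) (rule subset_trans)
  \<comment> \<open>Closure of \<open>C\<close> under joins of mail-connected sets enters here,
    applied to a component.\<close>
  have j_A: "j y x \<in> A y" if y: "y \<in> carrier L" and x: "x \<in> A y" for x y
  proof -
    let ?K = "mail_component P (A y) x"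
    have K: "?K \<subseteq> A y" "mail_connected P ?K"
      using x A_sub(1)[of y] by (simp_all add: mail_component_subset mail_connected_mail_component)
    then have "j y x \<in> C"
      using sub A_sub unfolding subchainmail_def j_def P_def by blast
    moreover have "j y x \<sqsubseteq> y"
      unfolding j_def using K(1) A_sub y by (intro sup_least) (auto simp: A_def)
    ultimately show ?thesis by (simp add: A_def)
  qed
  have disc: "totally_mail_disconnected P (g y)" if y: "y \<in> carrier L" for y
    unfolding totally_mail_disconnected_def
  proof (intro conjI ballI impI)
    show "g y \<subseteq> carrier P"
      using j_A[OF y] A_sub by (auto simp: g_eq)
    fix s t assume "s \<in> g y" "t \<in> g y" and ne: "s \<noteq> t"
    then obtain u v where u: "u \<in> A y" "s = j y u" and v: "v \<in> A y" "t = j y v"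
      by (auto simp: g_eq)
    show "Lower P {s, t} = {}"
    proof (rule ccontr)
      assume "Lower P {s, t} \<noteq> {}"
      \<comment> \<open>Links run between elements of \<open>A y\<close>, so the joins themselves
        must lie there.\<close>
      moreover have st: "s \<in> A y" "t \<in> A y"
        using u v j_A[OF y] by auto
      ultimately have "(s, t) \<in> mail_links P (A y)"
        using A_sub(1) by (auto simp: mail_links_def mail_def)
      \<comment> \<open>Comparable elements form a mail, so \<open>u\<close> is linked to its join
        \<open>s\<close>, and \<open>v\<close> to \<open>t\<close>. The mail \<open>{s, t}\<close>
        completes a path from \<open>u\<close> to \<open>v\<close>, and equal components have equal
        joins.\<close>
      moreover have "(u, s) \<in> mail_links P (A y)" "(v, t) \<in> mail_links P (A y)"
        using u v st j_upper[of u y] j_upper[of v y] P.mail_if_le[of u s] P.mail_if_le[of v t]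
          subsetD[OF A_sub(1)[of y]]
        by (simp_all add: mail_links_def)
      ultimately have "(u, v) \<in> (mail_links P (A y))\<^sup>*"
        by (meson mail_links_rtrancl_sym r_into_rtrancl rtrancl_trans)
      then have "s = t"
        using mail_component_eq[of u v P "A y"] u v by (simp add: j_def)
      with ne show False by contradiction
    qed
  qed
  have adj: "\<Squnion>S \<sqsubseteq> y \<longleftrightarrow> (\<forall>x\<in>S. \<exists>t\<in>g y. x \<sqsubseteq> t)"
    if S: "S \<subseteq> C" and y: "y \<in> carrier L" for S y
  proof
    assume below: "\<Squnion>S \<sqsubseteq> y"
    have "S \<subseteq> carrier L"
      using S C by blast
    then have "x \<in> A y" if "x \<in> S" for x
      using le_trans[OF sup_upper[OF _ that] below] that S y by (auto simp: A_def)
    then show "\<forall>x\<in>S. \<exists>t\<in>g y. x \<sqsubseteq> t"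
      using j_upper unfolding g_eq by blast
  next
    assume R: "\<forall>x\<in>S. \<exists>t\<in>g y. x \<sqsubseteq> t"
    show "\<Squnion>S \<sqsubseteq> y"
    \<comment> \<open>Every member of \<open>g y\<close> lies in \<open>A y\<close> by
      \<open>j_A\<close>, hence below \<open>y\<close>; so \<open>y\<close> bounds \<open>S\<close>
      from above.\<close>
    proof (rule sup_least)
      fix x assume x: "x \<in> S"
      then obtain t where t: "t \<in> A y" "x \<sqsubseteq> t"
        using R j_A[OF y] unfolding g_eq by blast
      moreover have "x \<in> carrier L" "t \<in> carrier L" "t \<sqsubseteq> y"
        using x S C t(1) by (auto simp: A_def)
      ultimately show "x \<sqsubseteq> y"
        using le_trans y by blast
    qed (use S C y in auto)
  qed
  let ?G = "\<lparr>orderA = disconnected_poset P, orderB = L, lower = (\<lambda>S. \<Squnion>S), upper = g\<rparr>"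
  show ?thesis
  proof (intro galois_connection.intro connection.intro galois_connection_axioms.intro)
    fix S y
    assume "S \<in> carrier (orderA ?G)" and "y \<in> carrier (orderB ?G)"
    then have "S \<subseteq> C" "y \<in> carrier L"
      by (auto simp: disconnected_poset_def totally_mail_disconnected_def)
    then show "lower ?G S \<sqsubseteq>\<^bsub>orderB ?G\<^esub> y \<longleftrightarrow> S \<sqsubseteq>\<^bsub>orderA ?G\<^esub> upper ?G y"
      using adj by (simp add: disconnected_poset_def)
  \<comment> \<open>It remains that both sides are partial orders and that both maps land in the
    right carriers; for \<open>g\<close> the latter is \<open>disc\<close>.\<close>
  qed (use partial_order_disconnected_poset[OF P.partial_order_axioms] partial_order_axioms C disc
      in \<open>auto simp: disconnected_poset_def totally_mail_disconnected_def\<close>)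
qed

theorem theorem22:
  fixes L :: "('a, 'm) gorder_scheme" and C :: "'a set"
  assumes "complete_lattice L" and "C \<subseteq> carrier L"
  shows "(\<exists>g. galois_connection
              \<lparr>orderA = disconnected_poset (L\<lparr>carrier := C\<rparr>), orderB = L,
               lower = (\<lambda>S. \<Squnion>\<^bsub>L\<^esub> S), upper = g\<rparr>)
         \<longleftrightarrow> subchainmail L C"
proof -
  interpret complete_lattice L by fact
  show ?thesis
    using subchainmail_if_adjoint[OF assms(2)] adjoint_if_subchainmail[of C] by blast
qed

end
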